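(* Let $\sigma>0$, $\mu>0$, $\nu>0$ and suppose that $f$ is a solution of the Riccati equation $\sigma xf'-\sigma f+\frac12f^2+2\sigma\nu+2\sigma\mu x^2=\frac12Ax^2+Bx+C$ with $A>0$. Then the PDE $$u_t=\sigma xu_{xx}+f(x)u_x-\left(\frac\nu x+\mu x\right)u$$ has a fundamental solution of the form $$p(t,x,y)=\frac{\sqrt{Axy}}{2\sigma\sinh(\sqrt At/2)}\,e^{-\left(Bt+\sqrt A(x+y)\coth(\sqrt At/2)+F(x)-F(y)\right)/(2\sigma)}\left(C_1(y)I_{d}\left(\frac{\sqrt{Axy}}{\sigma\sinh(\sqrt At/2)}\right)+C_2(y)I_{-d}\left(\frac{\sqrt{Axy}}{\sigma\sinh(\sqrt At/2)}\right)\right),\qquad d=\frac{\sqrt{\sigma^2+2C}}{\sigma},$$ for some functions $C_1(y),C_2(y)$. Here $F'(x)=f(x)/x$ and $I_{-d}(z)$ is interpreted as $K_d(z)$ if $d$ is an integer.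
   Context: The PDE is considered for $x\ge 0$, $t>0$. $I_d,K_d$ are the modified Bessel functions of the first and second kind. A fundamental solution of the PDE is a kernel $p(t,x,y)$, $t>0$, $x,y\ge 0$, such that for suitable initial data $\varphi$ (e.g. continuous with compact support in $(0,\infty)$) the function $u(x,t)=\int_0^\infty\varphi(y)p(t,x,y)\,dy$ solves the PDE for $t>0$ and satisfies $u(x,0)=\varphi(x)$. Fundamental solutions need not be unique. *)

theory Defs
  imports "HOL-Analysis.Analysis"
begin

text \<open>
  Modified Bessel function of the first kind for real order and argument \<open>z > 0\<close>. The entire
  function \<open>rGamma = 1/Gamma\<close> makes the series correct for negative orders too, including the
  negative integers. (At \<open>z = 0\<close> the value is \<open>0\<close>, since \<open>0 powr d = 0\<close> for every \<open>d\<close>.)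
\<close>

definition bessel_I :: "real \<Rightarrow> real \<Rightarrow> real" where
  "bessel_I d z = (z / 2) powr d * (\<Sum>k. (z\<^sup>2 / 4) ^ k * rGamma (d + real k + 1) / fact k)"

text \<open>
  Modified Bessel function of the second kind: the usual quotient
  \<open>\<pi>/2 (I\<^bsub>-d\<^esub>(z) - I\<^bsub>d\<^esub>(z)) / sin(d\<pi>)\<close>, and its limit in the order at integers.
\<close>

definition bessel_K :: "real \<Rightarrow> real \<Rightarrow> real" where
  "bessel_K d z =
     (let Q = (\<lambda>a. pi / 2 * (bessel_I (- a) z - bessel_I a z) / sin (a * pi))
      in if d \<in> \<int> then Lim (at d) Q else Q d)"

text \<open>The convention that \<open>I\<^bsub>-d\<^esub>\<close> means \<open>K\<^bsub>d\<^esub>\<close> when \<open>d\<close> is an integer.\<close>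

definition bessel_I_neg :: "real \<Rightarrow> real \<Rightarrow> real" where
  "bessel_I_neg d z = (if d \<in> \<int> then bessel_K d z else bessel_I (- d) z)"

text \<open>
  Classical solutions of \<open>u\<^sub>t = \<sigma> x u\<^sub>x\<^sub>x + f(x) u\<^sub>x - (\<nu>/x + \<mu> x) u\<close> for \<open>t > 0\<close>; here
  \<open>u x t\<close> has the space variable first. The point \<open>x = 0\<close>, at which the coefficient \<open>\<nu>/x\<close> is
  undefined, is left out.
\<close>

definition solves_pde ::
  "real \<Rightarrow> real \<Rightarrow> real \<Rightarrow> (real \<Rightarrow> real) \<Rightarrow> (real \<Rightarrow> real \<Rightarrow> real) \<Rightarrow> bool" where
  "solves_pde \<sigma> \<mu> \<nu> f u \<longleftrightarrow>
     (\<exists>u\<^sub>t u\<^sub>x u\<^sub>x\<^sub>x. \<forall>x>0. \<forall>t>0.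
        ((\<lambda>s. u x s) has_real_derivative u\<^sub>t x t) (at t) \<and>
        ((\<lambda>z. u z t) has_real_derivative u\<^sub>x x t) (at x) \<and>
        ((\<lambda>z. u\<^sub>x z t) has_real_derivative u\<^sub>x\<^sub>x x t) (at x) \<and>
        u\<^sub>t x t = \<sigma> * x * u\<^sub>x\<^sub>x x t + f x * u\<^sub>x x t - (\<nu> / x + \<mu> * x) * u x t)"

text \<open>
  The initial data are the continuous functions with compact support in \<open>(0,\<infinity>)\<close>, and
  \<open>u(x,0) = \<phi>(x)\<close> is understood as a limit for \<open>t\<close> decreasing to \<open>0\<close>. Integrability is required
  explicitly because the Lebesgue integral of a non-integrable function is \<open>0\<close> by convention.
\<close>

definition fundamental_solution ::
  "real \<Rightarrow> real \<Rightarrow> real \<Rightarrow> (real \<Rightarrow> real) \<Rightarrow> (real \<Rightarrow> real \<Rightarrow> real \<Rightarrow> real) \<Rightarrow> bool" where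
  "fundamental_solution \<sigma> \<mu> \<nu> f p \<longleftrightarrow>
     (\<forall>\<phi>. continuous_on UNIV \<phi> \<and>
          compact (closure {y. \<phi> y \<noteq> 0}) \<and> closure {y. \<phi> y \<noteq> 0} \<subseteq> {0<..} \<longrightarrow>
        (\<forall>x\<ge>0. \<forall>t>0. set_integrable lborel {0<..} (\<lambda>y. \<phi> y * p t x y)) \<and>
        (let u = (\<lambda>x t. LINT y:{0<..}|lborel. \<phi> y * p t x y)
         in solves_pde \<sigma> \<mu> \<nu> f u \<and> (\<forall>x\<ge>0. ((\<lambda>t. u x t) \<longlongrightarrow> \<phi> x) (at_right 0))))"

end

theory Submission
  imports Defs
begin

text \<open>
  The choice \<open>C\<^sub>1(y) = 1/y\<close>, \<open>C\<^sub>2 = 0\<close> works. Write \<open>I\<^sub>d(z) = (z/2)\<^sup>d g(z\<^sup>2/4)\<close> with \<open>g\<close> entire and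
  \<open>w g'' + (d+1) g' = g\<close>. With \<open>c = \<surd>A coth(\<surd>A t/2) / (2\<sigma>)\<close>,
  \<open>\<beta> = A / (4\<sigma>\<^sup>2 sinh\<^sup>2(\<surd>A t/2))\<close> and \<open>m = (d+1)/2\<close>, the kernel is, up to a factor depending on
  \<open>y\<close> only,
  \<open>exp(-(Bt + F(x))/(2\<sigma>)) (x\<beta>)\<^sup>m exp(-c(x+y)) g(\<beta>xy)\<close>, and the equation follows from the Riccati
  equation, \<open>c' = -\<sigma>\<beta>\<close>, \<open>\<beta>' = -2\<sigma>c\<beta>\<close> and \<open>c\<^sup>2 - \<beta> = A/(4\<sigma>\<^sup>2)\<close>; it passes under the integral sign since
  the initial datum has compact support in \<open>(0,\<infinity>)\<close>. For the initial condition no asymptotics of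
  \<open>I\<^sub>d\<close> are needed: as a function of \<open>y\<close> the kernel is a smooth factor times the probability density
  proportional to \<open>y\<^sup>d exp(-cy) g(by)\<close>, \<open>b = x\<beta>\<close>, a Poisson mixture of Gamma densities, whose mean tends
  to \<open>x\<close> and whose variance tends to \<open>0\<close>. That \<open>\<sigma>\<^sup>2 + 2C > 0\<close>, so that \<open>d\<close> is a genuine square root,
  follows from \<open>\<nu> > 0\<close> and the existence of the Riccati solution near \<open>x = 0\<close>.
\<close>

section \<open>The Riccati equation near the origin\<close>

text \<open>
  Otherwise \<open>arctan((f(x) - \<sigma>)/r) + r/(2\<sigma>) ln x\<close>, with \<open>r\<^sup>2 = -(\<sigma>\<^sup>2 + 2c)/2\<close>, would be decreasing near
  \<open>0\<close> although it tends to \<open>-\<infinity>\<close> there.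
\<close>

lemma riccati_nonoscillatory:
  fixes f f' :: "real \<Rightarrow> real" and \<sigma> a b c :: real
  assumes \<sigma>: "\<sigma> > 0"
    and f: "\<And>x. x > 0 \<Longrightarrow> (f has_real_derivative f' x) (at x)"
    and ric: "\<And>x. x > 0 \<Longrightarrow>
      \<sigma> * x * f' x - \<sigma> * f x + 1/2 * (f x)\<^sup>2 = a * x\<^sup>2 + b * x + c"
  shows "\<sigma>\<^sup>2 + 2 * c \<ge> 0"
proof (rule ccontr)
  assume "\<not> \<sigma>\<^sup>2 + 2 * c \<ge> 0"
  define r where "r = sqrt (- (\<sigma>\<^sup>2 + 2 * c) / 2)"
  have r: "r > 0" and r2: "r\<^sup>2 = - (\<sigma>\<^sup>2 + 2 * c) / 2"
    using \<open>\<not> \<sigma>\<^sup>2 + 2 * c \<ge> 0\<close> by (auto simp: r_def)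
  \<comment> \<open>Since x^2 <= x on (0,1], these two constants give a x^2 + b x <= r^2/2 on (0,
    \<open>x0\<close>], so that half of the negative margin in the Riccati equation is kept.\<close>
  define K where "K = \<bar>a\<bar> + \<bar>b\<bar> + 1"
  define x0 where "x0 = min 1 (r\<^sup>2 / (2 * K))"
  have K: "K > 0" by (simp add: K_def)
  have x0: "x0 > 0" using r K by (simp add: x0_def)
  define h where "h x = arctan ((f x - \<sigma>) / r) + r / (2 * \<sigma>) * ln x" for x
  define h' where "h' x = inverse (1 + ((f x - \<sigma>) / r)\<^sup>2) * (f' x / r) + r / (2 * \<sigma>) * (1 / x)" for x
  have h: "(h has_real_derivative h' x) (at x)" if "x > 0" for x
    unfolding h_def h'_def using that r \<sigma>
    by (auto intro!: derivative_eq_intros f[OF that] simp: divide_simps)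
  have bound: "a * x\<^sup>2 + b * x \<le> r\<^sup>2 / 2" if "0 < x" "x \<le> x0" for x
  proof -
    have "a * x\<^sup>2 \<le> \<bar>a\<bar> * x"
      using that mult_mono[of a "\<bar>a\<bar>" "x\<^sup>2" x] by (simp add: x0_def power2_eq_square mult_left_le)
    moreover have "b * x \<le> \<bar>b\<bar> * x" using that by (simp add: mult_right_mono)
    ultimately have "a * x\<^sup>2 + b * x \<le> K * x"
      using that by (simp only: K_def distrib_right)
    also have "\<dots> \<le> K * (r\<^sup>2 / (2 * K))"
      using that K by (intro mult_left_mono) (auto simp: x0_def)
    finally show ?thesis using K by simp
  qed
  have h'_le: "h' x \<le> 0" if "0 < x" "x \<le> x0" for x
  proof -
    define Q where "Q = r\<^sup>2 + (f x - \<sigma>)\<^sup>2"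
    have Q: "Q > 0" using r by (simp add: Q_def add_pos_nonneg)
    \<comment> \<open>Completing the square in f turns the constants of the Riccati equation into
      \<sigma>^2 + 2c = -2 r^2.\<close>
    have "2 * (\<sigma> * x * f' x) = 2 * (a * x\<^sup>2 + b * x) - 2 * r\<^sup>2 - (f x - \<sigma>)\<^sup>2"
      using ric[OF that(1)] r2 by (simp add: power2_eq_square algebra_simps)
    also have "\<dots> \<le> - Q" using bound[OF that] by (simp add: Q_def)
    finally have "2 * \<sigma> * x * f' x + Q \<le> 0" by (simp add: mult_ac)
    moreover have "h' x = r / (2 * \<sigma> * x * Q) * (2 * \<sigma> * x * f' x + Q)"
    proof -
      have "inverse (1 + ((f x - \<sigma>) / r)\<^sup>2) = r\<^sup>2 / Q"
        using r Q by (simp add: Q_def field_simps power_divide)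
      then show ?thesis
        using r Q \<sigma> that by (simp add: h'_def field_simps power2_eq_square)
    qed
    ultimately show ?thesis
      using r \<sigma> that Q by (simp only:) (intro mult_nonneg_nonpos divide_nonneg_nonneg, auto)
  qed
  have mono: "h x0 \<le> h x" if "0 < x" "x \<le> x0" for x
    using that h h'_le by (intro DERIV_nonpos_imp_nonincreasing[of x x0 h]) force+
  \<comment> \<open>So small that the logarithmic term outweighs the supremum pi/2 of the arctangent
    and pushes \<open>h x\<close> below \<open>h x0\<close>.\<close>
  define x where "x = min x0 (exp ((h x0 - pi / 2 - 1) * (2 * \<sigma>) / r))"
  have x: "0 < x" "x \<le> x0" using x0 by (auto simp: x_def)
  have "ln x \<le> (h x0 - pi / 2 - 1) * (2 * \<sigma>) / r"
    using x(1) ln_le_cancel_iff[of x "exp ((h x0 - pi / 2 - 1) * (2 * \<sigma>) / r)"] by (simp add: x_def)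
  then have "r / (2 * \<sigma>) * ln x \<le> h x0 - pi / 2 - 1"
    using r \<sigma> by (simp add: field_simps)
  moreover have "arctan ((f x - \<sigma>) / r) < pi / 2" by (rule arctan_ubound)
  ultimately have "h x < h x0" by (simp add: h_def)
  with mono[OF x] show False by simp
qed

section \<open>The Bessel--Clifford function\<close>

text \<open>What remains of I_d(z) after division by (z/2)^d, in the variable w = z^2/4. For d >= 0
  it is regular at w = 0, and differentiation merely raises d by one.\<close>

definition bessel_clifford :: "real \<Rightarrow> real \<Rightarrow> real" where
  "bessel_clifford d w = (\<Sum>k. rGamma (d + real k + 1) / fact k * w ^ k)"

lemma bessel_I_clifford:
  "bessel_I d z = (z / 2) powr d * bessel_clifford d (z\<^sup>2 / 4)"
  by (simp add: bessel_I_def bessel_clifford_def field_simps)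

lemma rGamma_pos: "rGamma x > 0" if "x > 0" for x :: real
  using that by (simp add: rGamma_inverse_Gamma Gamma_real_pos)

text \<open>The functional equation 1/Gamma(x) = x/Gamma(x+1) with x >= 1. The bound lets the
  exponential series dominate the Bessel series.\<close>

lemma rGamma_add_nat_le:
  fixes d :: real assumes "d \<ge> 0" shows "rGamma (d + real k + 1) \<le> rGamma (d + 1)"
proof (induction k)
  case (Suc k)
  have "rGamma (d + real (Suc k) + 1) \<le> (d + real k + 1) * rGamma (d + real (Suc k) + 1)"
    using assms rGamma_pos[of "d + real (Suc k) + 1"] mult_right_mono[of 1 "d + real k + 1"] by force
  also have "\<dots> = rGamma (d + real k + 1)"
    using rGamma_plus1[of "d + real k + 1"] by (simp add: add_ac)
  finally show ?case using Suc by simp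
qed simp

lemma summable_bessel_clifford:
  fixes d w :: real
  assumes "d \<ge> 0"
  shows "summable (\<lambda>k. rGamma (d + real k + 1) / fact k * w ^ k)"
proof (rule summable_comparison_test')
  show "summable (\<lambda>k. rGamma (d + 1) * (\<bar>w\<bar> ^ k / fact k))"
    using summable_exp[of "\<bar>w\<bar>"] by (intro summable_mult) (simp add: field_simps)
  show "norm (rGamma (d + real k + 1) / fact k * w ^ k) \<le> rGamma (d + 1) * (\<bar>w\<bar> ^ k / fact k)" for k
    using rGamma_add_nat_le[OF assms, of k] rGamma_pos[of "d + real k + 1"] assms
    by (auto simp: abs_mult power_abs intro!: divide_right_mono mult_right_mono)
qed

lemma bessel_clifford_sums:
  assumes "d \<ge> 0"
  shows "(\<lambda>k. rGamma (d + real k + 1) / fact k * w ^ k) sums bessel_clifford d w"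
  using summable_sums[OF summable_bessel_clifford[OF assms]] by (simp add: bessel_clifford_def)

text \<open>Termwise: the factor k + 1 produced by the derivative cancels against the factorial, and
  only the shift in the argument of \<open>rGamma\<close> survives.\<close>

lemma has_field_derivative_bessel_clifford:
  assumes "d \<ge> 0"
  shows "(bessel_clifford d has_real_derivative bessel_clifford (d + 1) w) (at w)"
proof -
  have "diffs (\<lambda>k. rGamma (d + real k + 1) / fact k) = (\<lambda>k. rGamma (d + 1 + real k + 1) / fact k)"
    by (auto simp: diffs_def add_ac)
  with termdiffs_strong_converges_everywhere[OF summable_bessel_clifford[OF assms], of w]
  show ?thesis by (simp add: bessel_clifford_def[abs_def])
qed

lemma has_real_derivative_bessel_clifford_chain [derivative_intros]:
  assumes "d \<ge> 0" "(g has_real_derivative g') (at x within S)"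
  shows "((\<lambda>x. bessel_clifford d (g x)) has_real_derivative
           bessel_clifford (d + 1) (g x) * g') (at x within S)"
  by (rule DERIV_chain2[OF has_field_derivative_bessel_clifford assms(2)]) (use assms in auto)

lemma continuous_on_bessel_clifford [continuous_intros]:
  assumes "d \<ge> 0" "continuous_on S g"
  shows "continuous_on S (\<lambda>x. bessel_clifford d (g x))"
proof -
  have "continuous_on UNIV (bessel_clifford d)"
    using has_field_derivative_bessel_clifford[OF assms(1)]
    by (meson DERIV_isCont continuous_at_imp_continuous_on)
  then show ?thesis by (rule continuous_on_compose2[OF _ assms(2)]) auto
qed

text \<open>The differential equation w g'' + (d+1) g' = g, with derivatives written as shifted
  orders. Coefficientwise it is (d+k+1)/Gamma(d+k+2) = 1/Gamma(d+k+1).\<close>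

lemma bessel_clifford_recurrence:
  assumes "d \<ge> 0"
  shows "bessel_clifford d w = (d + 1) * bessel_clifford (d + 1) w + w * bessel_clifford (d + 2) w"
proof -
  let ?a = "\<lambda>k. (d + 1) * (rGamma (d + 1 + real k + 1) / fact k * w ^ k)"
  \<comment> \<open>The factor k makes \<open>b 0\<close> vanish, so shifting the series for w g''
    by one index leaves no boundary term.\<close>
  define b where "b k = real k * rGamma (d + real k + 2) / fact k * w ^ k" for k
  have "(\<lambda>k. w * (rGamma (d + 2 + real k + 1) / fact k * w ^ k)) sums (w * bessel_clifford (d + 2) w)"
    using assms by (intro sums_mult bessel_clifford_sums) auto
  moreover have "w * (rGamma (d + 2 + real k + 1) / fact k * w ^ k) = b (Suc k)" for k
    by (simp add: b_def add_ac)
  ultimately have "(\<lambda>k. b (Suc k)) sums (w * bessel_clifford (d + 2) w)" by simp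
  then have "b sums (w * bessel_clifford (d + 2) w)"
    by (subst (asm) sums_Suc_iff) (simp add: b_def)
  then have "(\<lambda>k. ?a k + b k) sums
      ((d + 1) * bessel_clifford (d + 1) w + w * bessel_clifford (d + 2) w)"
    using assms by (intro sums_add sums_mult bessel_clifford_sums) auto
  moreover have "?a k + b k = rGamma (d + real k + 1) / fact k * w ^ k" for k
  proof -
    have "?a k + b k = (d + real k + 1) * rGamma (d + real k + 1 + 1) / fact k * w ^ k"
      by (simp add: b_def field_simps)
    then show ?thesis by (simp only: rGamma_plus1)
  qed
  ultimately show ?thesis
    using bessel_clifford_sums[OF assms, of w] sums_unique2 by fastforce
qed

lemma bessel_clifford_nonneg:
  assumes "d \<ge> 0" "w \<ge> 0" shows "bessel_clifford d w \<ge> 0"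
  using assms unfolding bessel_clifford_def
  by (intro suminf_nonneg summable_bessel_clifford) (auto intro!: mult_nonneg_nonneg divide_nonneg_nonneg less_imp_le[OF rGamma_pos])

section \<open>Moments of the Bessel density\<close>

text \<open>Substitution t = c y in Euler's integral. The extended nonnegative integral allows
  series of such terms to be summed before integrability is known.\<close>

lemma nn_integral_Gamma_scaled:
  fixes a c :: real
  assumes "a > 0" "c > 0"
  shows "(\<integral>\<^sup>+y. ennreal (indicator {0<..} y * (y powr (a - 1) * exp (- (c * y)))) \<partial>lborel)
           = ennreal (Gamma a / c powr a)" (is "?I = _")
proof -
  let ?f = "\<lambda>t. ennreal (t powr (a - 1) / exp t) * indicator {0..} t"
  have "ennreal (Gamma a) = (\<integral>\<^sup>+t. ?f t \<partial>lborel)"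
    using nn_integral_has_integral_lebesgue'[OF _ Gamma_integral_real[OF assms(1)]] by simp
  also have "\<dots> = ennreal c * (\<integral>\<^sup>+y. ?f (0 + c * y) \<partial>lborel)"
    using assms by (subst nn_integral_real_affine[where c = c and t = 0]) auto
  also have "(\<integral>\<^sup>+y. ?f (0 + c * y) \<partial>lborel) = (\<integral>\<^sup>+y. ennreal (c powr (a - 1)) *
      ennreal (indicator {0<..} y * (y powr (a - 1) * exp (- (c * y)))) \<partial>lborel)"
    using assms
    by (intro nn_integral_cong)
       (auto simp: indicator_def powr_mult exp_minus field_simps zero_le_mult_iff
             simp flip: ennreal_mult)
  also have "\<dots> = ennreal (c powr (a - 1)) * ?I"
    by (rule nn_integral_cmult) auto
  also have "ennreal c * (ennreal (c powr (a - 1)) * ?I) = ennreal (c powr a) * ?I"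
    using assms by (simp add: powr_diff flip: mult.assoc ennreal_mult)
  finally have "ennreal (Gamma a) = ennreal (c powr a) * ?I" .
  then have "ennreal (1 / c powr a) * ennreal (Gamma a) =
      (ennreal (1 / c powr a) * ennreal (c powr a)) * ?I"
    by (simp add: mult.assoc)
  also have "ennreal (1 / c powr a) * ennreal (c powr a) = 1"
    using assms by (simp flip: ennreal_mult)
  finally show ?thesis using assms by (simp flip: ennreal_mult)
qed

text \<open>Monotone convergence for the partial sums; the finite total S gives integrability of the
  limit together with its integral.\<close>

lemma has_bochner_integral_sums_nonneg:
  fixes f :: "nat \<Rightarrow> 'a \<Rightarrow> real"
  assumes meas: "\<And>k. f k \<in> borel_measurable M" and nonneg: "\<And>k x. f k x \<ge> 0"
    and int: "\<And>k. (\<integral>\<^sup>+x. ennreal (f k x) \<partial>M) = ennreal (I k)" and I: "\<And>k. I k \<ge> 0"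
    and sums: "I sums S" "\<And>x. (\<lambda>k. f k x) sums g x"
  shows "has_bochner_integral M g S"
proof (rule has_bochner_integral_nn_integral)
  have g: "g x = (\<Sum>k. f k x)" for x using sums(2) by (simp add: sums_iff)
  then have "g = (\<lambda>x. \<Sum>k. f k x)" by auto
  then show "g \<in> borel_measurable M" using meas by simp
  show "AE x in M. 0 \<le> g x" using sums(2) nonneg g by (auto simp: sums_iff suminf_nonneg)
  show "0 \<le> S" using sums(1) I by (auto simp: sums_iff suminf_nonneg)
  have "(\<integral>\<^sup>+x. ennreal (g x) \<partial>M) = (\<integral>\<^sup>+x. (\<Sum>k. ennreal (f k x)) \<partial>M)"
    using sums(2) nonneg by (intro nn_integral_cong suminf_ennreal_eq[symmetric]) auto
  also have "\<dots> = (\<Sum>k. \<integral>\<^sup>+x. ennreal (f k x) \<partial>M)"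
    using meas by (intro nn_integral_suminf) auto
  also have "\<dots> = ennreal S"
    unfolding int using sums(1) I by (intro suminf_ennreal_eq)
  finally show "(\<integral>\<^sup>+x. ennreal (g x) \<partial>M) = ennreal S" .
qed

text \<open>Integrating the series termwise gives Gamma integrals, and Gamma(d+k+1+j)/Gamma(d+k+1)
  is a rising factorial. The j-th moment thus becomes a sum with unnormalized Poisson weights of
  parameter b/c, left as the hypothesis \<open>S\<close>.\<close>

lemma has_bochner_integral_bessel_clifford_moment:
  fixes b c d :: real and j :: nat
  assumes b: "b \<ge> 0" and c: "c > 0" and d: "d \<ge> 0"
    and S: "(\<lambda>k. pochhammer (d + real k + 1) j * ((b / c) ^ k / fact k)) sums S"
  shows "has_bochner_integral lborel
    (\<lambda>y. indicator {0<..} y * (y powr (d + real j) * exp (- (c * y)) * bessel_clifford d (b * y)))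
    (S / c powr (d + real j + 1))"
proof (rule has_bochner_integral_sums_nonneg)
  let ?r = "\<lambda>k. rGamma (d + real k + 1) / fact k * b ^ k"
  let ?f = "\<lambda>k y. ?r k * (indicator {0<..} y *
    (y powr ((d + real j + real k + 1) - 1) * exp (- (c * y))))"
  let ?I = "\<lambda>k. ?r k * (Gamma (d + real j + real k + 1) / c powr (d + real j + real k + 1))"
  have r: "?r k \<ge> 0" for k
    using b d by (intro mult_nonneg_nonneg divide_nonneg_nonneg less_imp_le[OF rGamma_pos]) auto
  show "?f k \<in> borel_measurable lborel" for k by simp
  show "?f k y \<ge> 0" for k y by (rule mult_nonneg_nonneg[OF r]) simp
  show "?I k \<ge> 0" for k
    using d by (intro mult_nonneg_nonneg[OF r] divide_nonneg_nonneg less_imp_le[OF Gamma_real_pos]) auto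
  show "(\<integral>\<^sup>+y. ennreal (?f k y) \<partial>lborel) = ennreal (?I k)" for k
  proof -
    have "(\<integral>\<^sup>+y. ennreal (?f k y) \<partial>lborel) = ennreal (?r k) *
        (\<integral>\<^sup>+y. ennreal (indicator {0<..} y *
    (y powr ((d + real j + real k + 1) - 1) * exp (- (c * y)))) \<partial>lborel)"
      using r[of k] by (subst nn_integral_cmult[symmetric]) (auto simp flip: ennreal_mult)
    then show ?thesis
      using r[of k] c d by (subst (asm) nn_integral_Gamma_scaled) (auto simp flip: ennreal_mult)
  qed
  show "?I sums (S / c powr (d + real j + 1))"
  proof -
    have "?I k = pochhammer (d + real k + 1) j * ((b / c) ^ k / fact k) / c powr (d + real j + 1)" for k
    proof -
      have "d + real k + 1 \<notin> \<int>\<^sub>\<le>\<^sub>0" using d by (auto elim!: nonpos_Ints_cases)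
      moreover have "c powr (d + real j + real k + 1) = c powr (d + real j + 1) * c ^ k"
        using c by (simp add: add_ac flip: powr_realpow powr_add)
      moreover have "Gamma (d + real j + real k + 1) = Gamma (d + real k + 1 + real j)"
        by (simp add: add_ac)
      ultimately show ?thesis
        using c d by (simp add: pochhammer_Gamma rGamma_inverse_Gamma field_simps)
    qed
    then show ?thesis using sums_divide[OF S] by simp
  qed
  show "(\<lambda>k. ?f k y) sums
      (indicator {0<..} y * (y powr (d + real j) * exp (- (c * y)) * bessel_clifford d (b * y)))" for y
  proof (cases "y > 0")
    case True
    have "(\<lambda>k. y powr (d + real j) * exp (- (c * y)) *
        (rGamma (d + real k + 1) / fact k * (b * y) ^ k)) sums
        (y powr (d + real j) * exp (- (c * y)) * bessel_clifford d (b * y))"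
      using d by (intro sums_mult bessel_clifford_sums)
    moreover have "y powr (d + real j + real k) = y powr (d + real j) * y ^ k" for k
      using True by (simp add: powr_add powr_realpow)
    ultimately show ?thesis
      using True by (simp add: mult_ac power_mult_distrib)
  qed simp
qed

text \<open>Factorial moments of the Poisson distribution without its normalization. Each follows
  from the previous one by an index shift, because k r^k/k! = r r^(k-1)/(k-1)! for k >= 1.\<close>

lemma sums_falling_factorial_exp:
  fixes r :: real
  shows "(\<lambda>k. r ^ k / fact k) sums exp r"
    and "(\<lambda>k. real k * (r ^ k / fact k)) sums (r * exp r)"
    and "(\<lambda>k. real k * (real k - 1) * (r ^ k / fact k)) sums (r\<^sup>2 * exp r)"
proof -
  show *: "(\<lambda>k. r ^ k / fact k) sums exp r"
    using exp_converges[of r] by (simp add: field_simps)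
  have "(\<lambda>k. real (Suc k) * (r ^ Suc k / fact (Suc k))) sums (r * exp r)"
    using sums_mult[OF *, of r] by (simp add: field_simps del: of_nat_Suc)
  then show **: "(\<lambda>k. real k * (r ^ k / fact k)) sums (r * exp r)"
    by (subst (asm) sums_Suc_iff) simp
  have "(\<lambda>k. real (Suc k) * (real (Suc k) - 1) * (r ^ Suc k / fact (Suc k))) sums (r * (r * exp r))"
  proof -
    have "real (Suc k) * (real (Suc k) - 1) * (r ^ Suc k / fact (Suc k)) =
        r * (real k * (r ^ k / fact k))" for k
      by (simp add: divide_simps)
    then show ?thesis using sums_mult[OF **, of r] by (simp only:)
  qed
  then show "(\<lambda>k. real k * (real k - 1) * (r ^ k / fact k)) sums (r\<^sup>2 * exp r)"
    by (subst (asm) sums_Suc_iff) (simp add: power2_eq_square mult.assoc)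
qed

text \<open>The mixture of Gamma densities of shape d+k+1 and rate c, with k Poisson of mean b/c. Up
  to the scale 2c it is the noncentral chi-squared law with 2(d+1) degrees of freedom.\<close>

definition bessel_density :: "real \<Rightarrow> real \<Rightarrow> real \<Rightarrow> real \<Rightarrow> real" where
  "bessel_density d b c y = c powr (d + 1) * exp (- (b / c)) *
     (indicator {0<..} y * (y powr d * exp (- (c * y)) * bessel_clifford d (b * y)))"

lemma bessel_density_nonneg:
  assumes "d \<ge> 0" "b \<ge> 0" shows "bessel_density d b c y \<ge> 0"
  using assms by (auto simp: bessel_density_def indicator_def intro!: mult_nonneg_nonneg bessel_clifford_nonneg)

text \<open>The second moment is taken about an arbitrary point x, not about the mean, since the
  Chebyshev argument is centred at the limit point.\<close>

lemma has_bochner_integral_bessel_density: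
  fixes b c d x :: real
  assumes b: "b \<ge> 0" and c: "c > 0" and d: "d \<ge> 0"
  defines "r \<equiv> b / c"
  shows "has_bochner_integral lborel (bessel_density d b c) 1"
    and "has_bochner_integral lborel (\<lambda>y. (y - x)\<^sup>2 * bessel_density d b c y)
      (((d + 1) * (d + 2) + 2 * (d + 2) * r + r\<^sup>2) / c\<^sup>2 - 2 * x * ((d + 1 + r) / c) + x\<^sup>2)"
proof -
  define K where "K = c powr (d + 1) * exp (- r)"
  define m where "m j y = indicator {0<..} y *
    (y powr (d + real j) * exp (- (c * y)) * bessel_clifford d (b * y))" for j :: nat and y
  have dens: "bessel_density d b c y = K * m 0 y" for y
    by (simp add: bessel_density_def K_def m_def r_def)
  note M = has_bochner_integral_bessel_clifford_moment[OF b c d, folded m_def r_def]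
  note E = sums_falling_factorial_exp[of r]
  have "has_bochner_integral lborel (m 0) (exp r / c powr (d + 1))"
    using M[of 0] E(1) by simp
  then have m0: "has_bochner_integral lborel (\<lambda>y. K * m 0 y) (K * (exp r / c powr (d + 1)))"
    by (intro has_bochner_integral_mult_right) auto
  moreover have K0: "K * (exp r / c powr (d + 1)) = 1"
    using c by (simp add: K_def flip: exp_add)
  ultimately show "has_bochner_integral lborel (bessel_density d b c) 1"
    by (simp only: dens[abs_def])
  have "(\<lambda>k. (d + 1) * (r ^ k / fact k) + real k * (r ^ k / fact k)) sums ((d + 1) * exp r + r * exp r)"
    by (intro sums_add sums_mult E)
  moreover have "(d + 1) * (r ^ k / fact k) + real k * (r ^ k / fact k) =
      pochhammer (d + real k + 1) 1 * (r ^ k / fact k)" for k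
    by (simp add: field_simps)
  ultimately have "(\<lambda>k. pochhammer (d + real k + 1) 1 * (r ^ k / fact k)) sums ((d + 1 + r) * exp r)"
    by (simp only: distrib_right)
  note m1 = M[OF this]
  \<comment> \<open>The rising factorial (d+k+1)(d+k+2) is expanded in the falling factorials 1, k,
    k(k-1), whose sums are known.\<close>
  have "(\<lambda>k. (d + 1) * (d + 2) * (r ^ k / fact k) + 2 * (d + 2) * (real k * (r ^ k / fact k)) +
      real k * (real k - 1) * (r ^ k / fact k)) sums
      ((d + 1) * (d + 2) * exp r + 2 * (d + 2) * (r * exp r) + r\<^sup>2 * exp r)"
    by (intro sums_add sums_mult E)
  moreover have "(d + 1) * (d + 2) * (r ^ k / fact k) + 2 * (d + 2) * (real k * (r ^ k / fact k)) +
      real k * (real k - 1) * (r ^ k / fact k) = pochhammer (d + real k + 1) 2 * (r ^ k / fact k)" for k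
  proof -
    have "pochhammer (d + real k + 1) 2 =
        (d + 1) * (d + 2) + 2 * (d + 2) * real k + real k * (real k - 1)"
      by (simp add: numeral_2_eq_2 pochhammer_Suc algebra_simps)
    then show ?thesis by (simp only: distrib_right mult.assoc)
  qed
  ultimately have "(\<lambda>k. pochhammer (d + real k + 1) 2 * (r ^ k / fact k)) sums
      (((d + 1) * (d + 2) + 2 * (d + 2) * r + r\<^sup>2) * exp r)"
    by (simp add: add_ac mult.assoc distrib_right)
  note m2 = M[OF this]
  have powr: "c powr (d + real j + 1) = c powr (d + 1) * c ^ j" for j
    using c by (simp add: add_ac flip: powr_realpow powr_add)
  have "has_bochner_integral lborel
      (\<lambda>y. K * m 2 y - (2 * x) * (K * m 1 y) + x\<^sup>2 * (K * m 0 y))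
      (K * (((d + 1) * (d + 2) + 2 * (d + 2) * r + r\<^sup>2) * exp r / c powr (d + real 2 + 1))
        - (2 * x) * (K * ((d + 1 + r) * exp r / c powr (d + real 1 + 1)))
        + x\<^sup>2 * (K * (exp r / c powr (d + 1))))"
    by (intro has_bochner_integral_add has_bochner_integral_diff has_bochner_integral_mult_right
        m1 m2 m0)
  moreover have "K * m 2 y - (2 * x) * (K * m 1 y) + x\<^sup>2 * (K * m 0 y) =
      (y - x)\<^sup>2 * bessel_density d b c y" for y
  proof (cases "y > 0")
    case True
    then have "m 1 y = y * m 0 y" "m 2 y = y\<^sup>2 * m 0 y"
      by (simp_all add: m_def powr_add powr_realpow flip: powr_numeral)
    then show ?thesis by (simp add: dens power2_eq_square algebra_simps)
  qed (simp add: m_def dens)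
  moreover have "K * (Q * exp r / c powr (d + real j + 1)) = Q / c ^ j" for Q and j :: nat
  proof -
    have "K * (Q * exp r / c powr (d + real j + 1)) = (K * (exp r / c powr (d + 1))) * (Q / c ^ j)"
      by (simp add: powr)
    then show ?thesis by (simp only: K0 mult_1)
  qed
  ultimately show "has_bochner_integral lborel (\<lambda>y. (y - x)\<^sup>2 * bessel_density d b c y)
      (((d + 1) * (d + 2) + 2 * (d + 2) * r + r\<^sup>2) / c\<^sup>2 - 2 * x * ((d + 1 + r) / c) + x\<^sup>2)"
    by (simp only: K0 power_one_right mult_1_right)
qed

section \<open>Integrals against concentrating densities\<close>

text \<open>Chebyshev: on \<open>\<bar>y - x\<bar> \<ge> \<delta>\<close> the deviation of \<open>h\<close> is at most \<open>2M (y - x)\<^sup>2 / \<delta>\<^sup>2\<close>.\<close>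

lemma tendsto_integral_concentrating:
  fixes q :: "'a \<Rightarrow> real \<Rightarrow> real" and h :: "real \<Rightarrow> real"
  assumes q: "\<forall>\<^sub>F t in G. (\<forall>y. q t y \<ge> 0) \<and> has_bochner_integral N (q t) 1 \<and>
      has_bochner_integral N (\<lambda>y. (y - x)\<^sup>2 * q t y) (V t)"
    and V: "(V \<longlongrightarrow> 0) G"
    and h: "h \<in> borel_measurable N" "\<And>y. \<bar>h y\<bar> \<le> M" "isCont h x"
  shows "((\<lambda>t. \<integral>y. h y * q t y \<partial>N) \<longlongrightarrow> h x) G"
proof (rule tendstoI)
  fix e :: real assume e: "e > 0"
  from h(3) e obtain \<delta> where \<delta>: "\<delta> > 0" "\<And>y. \<bar>y - x\<bar> < \<delta> \<Longrightarrow> \<bar>h y - h x\<bar> < e / 2"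
    unfolding continuous_at dist_real_def LIM_def
    by (metis e h(3) continuous_at_eps_delta dist_real_def half_gt_zero_iff)
  have M: "M \<ge> 0" using h(2)[of 0] by linarith
  define L where "L = 2 * M / \<delta>\<^sup>2"
  have L: "L \<ge> 0" using M by (simp add: L_def)
  \<comment> \<open>A single bound for all y: continuity supplies e/2 near x, and the quadratic term
    dominates elsewhere. The integral then need not be split.\<close>
  have dev: "\<bar>h y - h x\<bar> \<le> e / 2 + L * (y - x)\<^sup>2" for y
  proof (cases "\<bar>y - x\<bar> < \<delta>")
    case True
    then show ?thesis using \<delta>(2)[OF True] L by (smt (verit) mult_nonneg_nonneg zero_le_power2)
  next
    case False
    then have "\<delta>\<^sup>2 \<le> (y - x)\<^sup>2" using \<delta>(1) by (simp add: abs_le_square_iff[symmetric])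
    then have "2 * M \<le> L * (y - x)\<^sup>2"
      using \<delta>(1) M mult_left_mono[of "\<delta>\<^sup>2" "(y - x)\<^sup>2" "2 * M"] by (simp add: L_def field_simps)
    then show ?thesis using h(2)[of y] h(2)[of x] e by linarith
  qed
  have "\<forall>\<^sub>F t in G. L * V t < e / 2"
    using e order_tendstoD(2)[OF tendsto_mult_left[OF V, of L], of "e / 2"] by simp
  with q show "\<forall>\<^sub>F t in G. dist (\<integral>y. h y * q t y \<partial>N) (h x) < e"
  proof eventually_elim
    case (elim t)
    then have q: "\<And>y. q t y \<ge> 0" and qi: "integrable N (q t)" "integral\<^sup>L N (q t) = 1"
      and qv: "integrable N (\<lambda>y. (y - x)\<^sup>2 * q t y)" "(\<integral>y. (y - x)\<^sup>2 * q t y \<partial>N) = V t"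
      by (auto simp: has_bochner_integral_iff)
    have hq: "integrable N (\<lambda>y. h y * q t y)"
    proof (rule Bochner_Integration.integrable_bound)
      show "integrable N (\<lambda>y. M * q t y)" using qi by simp
      show "(\<lambda>y. h y * q t y) \<in> borel_measurable N"
        using h(1) qi(1) by (intro borel_measurable_times) auto
      show "AE y in N. norm (h y * q t y) \<le> norm (M * q t y)"
        using h(2) M q by (auto simp: abs_mult intro!: mult_right_mono)
    qed
    have "(\<integral>y. h y * q t y \<partial>N) - h x = (\<integral>y. (h y - h x) * q t y \<partial>N)"
      using hq qi by (simp add: left_diff_distrib)
    also have "\<bar>\<dots>\<bar> \<le> (\<integral>y. \<bar>(h y - h x) * q t y\<bar> \<partial>N)" by (rule integral_abs_bound)
    also have "\<dots> \<le> (\<integral>y. e / 2 * q t y + L * ((y - x)\<^sup>2 * q t y) \<partial>N)"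
    proof (rule integral_mono)
      show "integrable N (\<lambda>y. \<bar>(h y - h x) * q t y\<bar>)"
        using hq qi by (intro integrable_abs) (simp add: left_diff_distrib)
      show "integrable N (\<lambda>y. e / 2 * q t y + L * ((y - x)\<^sup>2 * q t y))"
        using qi qv by (intro Bochner_Integration.integrable_add integrable_mult_right)
      fix y
      have "\<bar>(h y - h x) * q t y\<bar> \<le> (e / 2 + L * (y - x)\<^sup>2) * q t y"
        using dev[of y] q[of y] by (simp add: abs_mult mult_right_mono)
      then show "\<bar>(h y - h x) * q t y\<bar> \<le> e / 2 * q t y + L * ((y - x)\<^sup>2 * q t y)"
        by (simp only: distrib_right mult.assoc)
    qed
    also have "\<dots> = e / 2 + L * V t"
      using qi qv by simp
    also have "\<dots> < e" using elim by simp
    finally show ?case by (simp add: dist_real_def)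
  qed
qed

section \<open>The kernel\<close>

text \<open>On an interval [a,b] with a > 0, powers of y and functions that are singular only at 0
  are continuous.\<close>

lemma compact_subset_pos_interval:
  fixes S :: "real set"
  assumes "compact S" "S \<subseteq> {0<..}"
  obtains a b where "0 < a" "a \<le> b" "S \<subseteq> {a..b}"
proof (cases "S = {}")
  case True
  then show ?thesis using that[of 1 1] by simp
next
  case False
  obtain a where a: "a \<in> S" "\<And>y. y \<in> S \<Longrightarrow> a \<le> y"
    using compact_attains_inf[OF assms(1) False] by blast
  obtain b where b: "b \<in> S" "\<And>y. y \<in> S \<Longrightarrow> y \<le> b"
    using compact_attains_sup[OF assms(1) False] by blast
  show ?thesis using a b assms(2) by (intro that[of a b]) auto
qed

section \<open>Integrals of the Bessel kernel and their derivatives\<close>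

text \<open>The index n counts derivatives in x: each one brings down a factor \<beta>y and raises
  the order of the Bessel-Clifford function by one.\<close>

definition bessel_transform ::
    "(real \<Rightarrow> real) \<Rightarrow> real \<Rightarrow> real \<Rightarrow> real \<Rightarrow> nat \<Rightarrow> real \<Rightarrow> real \<Rightarrow> real \<Rightarrow> real" where
  "bessel_transform \<psi> a b d n c \<beta> x = integral {a..b}
     (\<lambda>y. \<psi> y * ((\<beta> * y) ^ n * exp (- (c * y)) * bessel_clifford (d + real n) (\<beta> * x * y)))"

lemma has_real_derivative_bessel_transform:
  fixes \<psi> :: "real \<Rightarrow> real"
  assumes \<psi>: "continuous_on {a..b} \<psi>" and d: "d \<ge> 0"
  shows "((\<lambda>x. bessel_transform \<psi> a b d n c \<beta> x) has_real_derivative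
           bessel_transform \<psi> a b d (Suc n) c \<beta> x) (at x)"
proof -
  have "((\<lambda>x. integral (cbox a b) (\<lambda>y. \<psi> y * ((\<beta> * y) ^ n * exp (- (c * y)) *
          bessel_clifford (d + real n) (\<beta> * x * y)))) has_real_derivative
        integral (cbox a b) (\<lambda>y. \<psi> y * ((\<beta> * y) ^ Suc n * exp (- (c * y)) *
          bessel_clifford (d + real (Suc n)) (\<beta> * x * y)))) (at x within UNIV)"
  proof (rule leibniz_rule_field_derivative)
    fix x y
    show "((\<lambda>x. \<psi> y * ((\<beta> * y) ^ n * exp (- (c * y)) * bessel_clifford (d + real n) (\<beta> * x * y)))
        has_real_derivative \<psi> y * ((\<beta> * y) ^ Suc n * exp (- (c * y)) *
          bessel_clifford (d + real (Suc n)) (\<beta> * x * y))) (at x within UNIV)"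
      using d by (auto intro!: derivative_eq_intros simp: add_ac mult_ac)
  next
    fix x
    show "(\<lambda>y. \<psi> y * ((\<beta> * y) ^ n * exp (- (c * y)) * bessel_clifford (d + real n) (\<beta> * x * y)))
        integrable_on cbox a b"
      using d \<psi> by (intro integrable_continuous continuous_intros) auto
  next
    show "continuous_on (UNIV \<times> cbox a b) (\<lambda>(x, y). \<psi> y * ((\<beta> * y) ^ Suc n * exp (- (c * y)) *
        bessel_clifford (d + real (Suc n)) (\<beta> * x * y)))"
      using d unfolding split_beta
      by (intro continuous_intros continuous_on_compose2[OF \<psi>]) auto
  qed auto
  then show ?thesis by (simp add: bessel_transform_def)
qed

text \<open>Differentiating exp(-cy) leaves \<sigma>\<beta>y g(\<beta>xy) under the integral. The
  recurrence replaces g by its first two derivatives, so the time derivative is expressed through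
  the derivatives \<open>J 1\<close> and \<open>J 2\<close> in x.\<close>

lemma has_real_derivative_bessel_transform_time:
  fixes \<psi> c \<beta> :: "real \<Rightarrow> real"
  assumes \<psi>: "continuous_on {a..b} \<psi>" and d: "d \<ge> 0" and t: "t > 0"
    and c: "\<And>t. t > 0 \<Longrightarrow> (c has_real_derivative - (\<sigma> * \<beta> t)) (at t)"
    and \<beta>: "\<And>t. t > 0 \<Longrightarrow> (\<beta> has_real_derivative - (2 * \<sigma> * c t * \<beta> t)) (at t)"
  defines "J \<equiv> \<lambda>n t x. bessel_transform \<psi> a b d n (c t) (\<beta> t) x"
  shows "((\<lambda>t. J 0 t x) has_real_derivative
           \<sigma> * (x * J 2 t x + (d + 1) * J 1 t x) - 2 * \<sigma> * c t * x * J 1 t x) (at t)"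
proof -
  have cont: "continuous_on {0<..} c" "continuous_on {0<..} \<beta>"
    using c \<beta> by (auto intro!: continuous_at_imp_continuous_on DERIV_isCont)
  define D where "D t y = \<psi> y * (exp (- (c t * y)) * (\<sigma> * \<beta> t * y) * bessel_clifford d (\<beta> t * x * y)
      - exp (- (c t * y)) * bessel_clifford (d + 1) (\<beta> t * x * y) * (2 * \<sigma> * c t * \<beta> t * x * y))" for t y
  \<comment> \<open>The Leibniz rule is applied on the half-line t > 0, where \<open>c\<close> and
    \<open>\<beta>\<close> are differentiable; as this set is open, a full derivative
    results.\<close>
  have "((\<lambda>t. integral (cbox a b) (\<lambda>y. \<psi> y * (exp (- (c t * y)) * bessel_clifford d (\<beta> t * x * y))))
      has_real_derivative integral (cbox a b) (D t)) (at t within {0<..})"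
  proof (rule leibniz_rule_field_derivative)
    fix s y :: real assume "s \<in> {0<..}"
    then have "s > 0" by simp
    have "((\<lambda>t. \<psi> y * (exp (- (c t * y)) * bessel_clifford d (\<beta> t * x * y)))
        has_real_derivative D s y) (at s)"
      using \<open>s > 0\<close> d unfolding D_def
      by (auto intro!: derivative_eq_intros c \<beta> simp: algebra_simps)
    then show "((\<lambda>t. \<psi> y * (exp (- (c t * y)) * bessel_clifford d (\<beta> t * x * y)))
        has_real_derivative D s y) (at s within {0<..})"
      by (rule DERIV_subset) simp
  next
    fix s :: real
    show "(\<lambda>y. \<psi> y * (exp (- (c s * y)) * bessel_clifford d (\<beta> s * x * y))) integrable_on cbox a b"
      using d \<psi> by (intro integrable_continuous continuous_intros) auto
  next
    show "continuous_on ({0<..} \<times> cbox a b) (\<lambda>(t, y). D t y)"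
      using d unfolding split_beta D_def
      by (intro continuous_intros continuous_on_compose2[OF \<psi>] continuous_on_compose2[OF cont(1)]
          continuous_on_compose2[OF cont(2)]) auto
  qed (use t in auto)
  moreover have "at t within {0<..} = at t" using t by (intro at_within_open) auto
  moreover have "integral (cbox a b) (D t) =
      \<sigma> * (x * J 2 t x + (d + 1) * J 1 t x) - 2 * \<sigma> * c t * x * J 1 t x"
  proof -
    define k where "k n y = \<psi> y * ((\<beta> t * y) ^ n * exp (- (c t * y)) *
      bessel_clifford (d + real n) (\<beta> t * x * y))" for n y
    have k: "k n integrable_on {a..b}" for n
      unfolding k_def using d \<psi> by (intro integrable_continuous_real continuous_intros) auto
    have J: "J n t x = integral {a..b} (k n)" for n
      by (simp add: J_def bessel_transform_def k_def[abs_def])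
    have "D t y = \<sigma> * (x * k 2 y + (d + 1) * k 1 y) - 2 * \<sigma> * c t * x * k 1 y" for y
      unfolding D_def k_def
      by (subst bessel_clifford_recurrence[OF d, of "\<beta> t * x * y"])
         (simp add: algebra_simps power2_eq_square)
    then have "D t = (\<lambda>y. \<sigma> * (x * k 2 y + (d + 1) * k 1 y) - 2 * \<sigma> * c t * x * k 1 y)" by auto
    then show ?thesis
      by (simp add: J k integral_diff integral_add integrable_diff integrable_add
          integrable_on_mult_right)
  qed
  ultimately show ?thesis by (simp add: J_def bessel_transform_def)
qed

section \<open>Coefficients and factorization of the kernel\<close>

locale riccati_diffusion =
  fixes \<sigma> \<mu> \<nu> A B C d :: real and f f' F :: "real \<Rightarrow> real"
  assumes pos: "\<sigma> > 0" "\<nu> > 0" "A > 0"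
    and f: "\<And>x. x > 0 \<Longrightarrow> (f has_real_derivative f' x) (at x)"
    and riccati: "\<And>x. x > 0 \<Longrightarrow>
      \<sigma> * x * f' x - \<sigma> * f x + 1/2 * (f x)\<^sup>2 + 2 * \<sigma> * \<nu> + 2 * \<sigma> * \<mu> * x\<^sup>2
        = 1/2 * A * x\<^sup>2 + B * x + C"
    and F: "\<And>x. x > 0 \<Longrightarrow> (F has_real_derivative f x / x) (at x)"
    and d_eq: "d = sqrt (\<sigma>\<^sup>2 + 2 * C) / \<sigma>"
begin

text \<open>\<open>c\<close> is the common exponential rate in x and in y, and
  \<open>\<beta>\<close> is scaled so that \<beta>xy = z^2/4 for the argument z of the Bessel
  function.\<close>

definition c where "c t = sqrt A * cosh (sqrt A * t / 2) / (2 * \<sigma> * sinh (sqrt A * t / 2))"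
definition \<beta> where "\<beta> t = A / (4 * \<sigma>\<^sup>2 * (sinh (sqrt A * t / 2))\<^sup>2)"
definition m where "m = (d + 1) / 2"

definition prefactor where
  "prefactor t x = exp (- (B * t) / (2 * \<sigma>)) * exp (- F x / (2 * \<sigma>)) * (x * \<beta> t) powr m * exp (- (c t * x))"

text \<open>The exponent of y collects 1/2 from the square root, d/2 from the Bessel function and -1
  from the choice 1/y.\<close>

definition weight where "weight y = exp (F y / (2 * \<sigma>)) * y powr ((d - 1) / 2)"

text \<open>Kept in the literal shape of the claim, including the zero multiple of the second Bessel
  function, so that unfolding yields the instantiated goal.\<close>

definition kernel where
  "kernel t x y = sqrt (A * x * y) / (2 * \<sigma> * sinh (sqrt A * t / 2))
      * exp (- (B * t + sqrt A * (x + y) * (cosh (sqrt A * t / 2) / sinh (sqrt A * t / 2))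
                + F x - F y) / (2 * \<sigma>))
      * (1 / y * bessel_I d (sqrt (A * x * y) / (\<sigma> * sinh (sqrt A * t / 2)))
         + 0 * bessel_I_neg d (sqrt (A * x * y) / (\<sigma> * sinh (sqrt A * t / 2))))"

text \<open>Moving the \<nu> term to the right makes the constant C - 2\<sigma>\<nu>.
  Non-oscillation bounds \<sigma>^2 + 2C below by 4\<sigma>\<nu> > 0.\<close>

lemma discriminant: "\<sigma>\<^sup>2 + 2 * C > 0"
proof -
  have "\<sigma> * x * f' x - \<sigma> * f x + 1/2 * (f x)\<^sup>2 =
      (A / 2 - 2 * \<sigma> * \<mu>) * x\<^sup>2 + B * x + (C - 2 * \<sigma> * \<nu>)" if "x > 0" for x
    using riccati[OF that] by (simp add: algebra_simps)
  from riccati_nonoscillatory[OF pos(1) f this]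
  have "\<sigma>\<^sup>2 + 2 * C \<ge> 4 * (\<sigma> * \<nu>)" by simp
  moreover have "\<sigma> * \<nu> > 0" using pos by simp
  ultimately show ?thesis by linarith
qed

lemma d_pos: "d > 0" and C_eq: "C = \<sigma>\<^sup>2 * (d\<^sup>2 - 1) / 2"
  using discriminant pos by (auto simp: d_eq power_divide field_simps)

lemma sinh_pos: "sinh (sqrt A * t / 2) > 0" if "t > 0"
  using that pos by simp

lemma c_pos: "c t > 0" and \<beta>_pos: "\<beta> t > 0" if "t > 0"
  using sinh_pos[OF that] pos by (auto simp: c_def \<beta>_def intro!: divide_pos_pos mult_pos_pos)

text \<open>From cosh^2 = sinh^2 + 1. The identity links the x^2 terms to A in the PDE and controls
  the ratio of \<open>\<beta>\<close> and \<open>c\<close> as t tends to 0.\<close>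

lemma c_square: "(c t)\<^sup>2 = \<beta> t + A / (4 * \<sigma>\<^sup>2)" if "t > 0"
proof -
  define s where "s = sinh (sqrt A * t / 2)"
  have "s > 0" using sinh_pos[OF that] by (simp add: s_def)
  then have "A * (s\<^sup>2 + 1) / (4 * \<sigma>\<^sup>2 * s\<^sup>2) = A / (4 * \<sigma>\<^sup>2 * s\<^sup>2) + A / (4 * \<sigma>\<^sup>2)"
    using pos by (simp add: field_simps)
  then show ?thesis
    using pos by (simp add: c_def \<beta>_def power_divide power_mult_distrib cosh_square_eq s_def)
qed

lemma has_derivative_c: "(c has_real_derivative - (\<sigma> * \<beta> t)) (at t)" if "t > 0"
proof -
  define s where "s = sinh (sqrt A * t / 2)"
  define ch where "ch = cosh (sqrt A * t / 2)"
  have s: "s > 0" using sinh_pos[OF that] by (simp add: s_def)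
  have ch: "ch\<^sup>2 - s\<^sup>2 = 1" by (simp add: s_def ch_def cosh_square_eq)
  have "(c has_real_derivative
      (sqrt A * (s * (sqrt A / 2)) * (2 * \<sigma> * s) - sqrt A * ch * (2 * \<sigma> * (ch * (sqrt A / 2)))) /
      ((2 * \<sigma> * s) * (2 * \<sigma> * s))) (at t)"
    unfolding c_def[abs_def] s_def ch_def using sinh_pos[OF that] pos
    by (auto intro!: derivative_eq_intros)
  moreover have "sqrt A * (s * (sqrt A / 2)) * (2 * \<sigma> * s) - sqrt A * ch * (2 * \<sigma> * (ch * (sqrt A / 2))) =
      - (sqrt A * sqrt A) * \<sigma> * (ch\<^sup>2 - s\<^sup>2)"
    by (simp only: power2_eq_square) (simp add: algebra_simps del: real_sqrt_mult_self)
  ultimately have "(c has_real_derivative - (A * \<sigma>) / ((2 * \<sigma> * s) * (2 * \<sigma> * s))) (at t)"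
    using pos by (simp add: ch)
  moreover have "- (A * \<sigma>) / ((2 * \<sigma> * s) * (2 * \<sigma> * s)) = - (\<sigma> * \<beta> t)"
    unfolding \<beta>_def s_def[symmetric] using s pos by (simp add: field_simps power2_eq_square)
  ultimately show ?thesis by simp
qed

lemma has_derivative_\<beta>: "(\<beta> has_real_derivative - (2 * \<sigma> * c t * \<beta> t)) (at t)" if "t > 0"
  unfolding \<beta>_def[abs_def] using sinh_pos[OF that] pos
  by (auto intro!: derivative_eq_intros simp: c_def \<beta>_def field_simps power2_eq_square)

text \<open>With w = \<beta>xy the leading factor is w^(1/2) and I_d(z) = w^(d/2) g(w). The powers
  and the exponential split between x and y, which remain coupled only through g(w).\<close>

lemma kernel_eq:
  assumes "t > 0" "x > 0" "y > 0"
  shows "kernel t x y =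
    prefactor t x * (weight y * (exp (- (c t * y)) * bessel_clifford d (\<beta> t * x * y)))"
proof -
  let ?s = "sinh (sqrt A * t / 2)"
  let ?z = "sqrt (A * x * y) / (\<sigma> * ?s)"
  let ?w = "\<beta> t * x * y"
  have w: "?w > 0" using \<beta>_pos[OF assms(1)] assms by simp
  have s: "?s > 0" using sinh_pos[OF assms(1)] .
  have z2: "(?z / 2)\<^sup>2 = ?w"
    using s pos assms by (simp add: \<beta>_def power_divide power_mult_distrib)
  have "?z / 2 > 0" using s pos assms by simp
  then have z: "?z / 2 = ?w powr (1/2)"
    using z2 w by (simp add: powr_half_sqrt real_sqrt_unique)
  have 1: "sqrt (A * x * y) / (2 * \<sigma> * ?s) = ?w powr (1/2)"
    using z by simp
  have 2: "bessel_I d ?z = ?w powr (d / 2) * bessel_clifford d ?w"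
  proof -
    have "?z\<^sup>2 / 4 = ?w" using z2 by (simp add: power_divide)
    moreover have "(?z / 2) powr d = ?w powr (d / 2)" by (simp only: z powr_powr) simp
    ultimately show ?thesis by (simp only: bessel_I_clifford)
  qed
  have 3: "exp (- (B * t + sqrt A * (x + y) * (cosh (sqrt A * t / 2) / ?s) + F x - F y) / (2 * \<sigma>)) =
      exp (- (B * t) / (2 * \<sigma>)) * exp (- F x / (2 * \<sigma>)) * exp (- (c t * x)) *
      exp (F y / (2 * \<sigma>)) * exp (- (c t * y))"
  proof -
    define r where "r = cosh (sqrt A * t / 2) / ?s"
    have "c t = sqrt A * r / (2 * \<sigma>)" by (simp add: c_def r_def)
    then show ?thesis
      unfolding r_def[symmetric] using pos by (simp add: field_simps flip: exp_add)
  qed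
  have 4: "?w powr (1/2) * (1 / y * ?w powr (d / 2)) = (x * \<beta> t) powr m * y powr ((d - 1) / 2)"
  proof -
    have "?w powr (1/2) * ?w powr (d / 2) = (x * \<beta> t * y) powr m"
      by (simp add: m_def mult_ac add_divide_distrib add.commute flip: powr_add)
    also have "\<dots> = (x * \<beta> t) powr m * y powr m"
      using assms \<beta>_pos[OF assms(1)] by (simp add: powr_mult)
    also have "y powr m = y * y powr ((d - 1) / 2)"
    proof -
      have "m = 1 + (d - 1) / 2" by (simp add: m_def field_simps)
      then show ?thesis using assms by (simp add: powr_add)
    qed
    finally show ?thesis using assms by (simp add: field_simps)
  qed
  \<comment> \<open>Regrouping for arbitrary factors, which brings the powers together so that
    \<open>4\<close> can rewrite them.\<close>
  have "?w powr (1/2) * (P * Q * R * S * T) * (1 / y * (?w powr (d / 2) * G) + 0 * q) =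
      (?w powr (1/2) * (1 / y * ?w powr (d / 2))) * (P * Q * R * S * T * G)" for P Q R S T G
    by simp
  then show ?thesis
    unfolding kernel_def 1 2 3 by (simp only: 4) (simp add: prefactor_def weight_def mult_ac)
qed

section \<open>Verification of the parabolic equation\<close>

text \<open>All derivatives of u are the prefactor times combinations of \<open>J 0\<close>,
  \<open>J 1\<close>, \<open>J 2\<close>, whose coefficients are compared. Those of
  \<open>J 2\<close> agree at once, \<open>eq1\<close> settles \<open>J 1\<close>, and the Riccati
  equation settles \<open>J 0\<close> in \<open>eq\<close>.\<close>

lemma integral_representation_solves:
  assumes \<psi>: "continuous_on {a..b} \<psi>"
    and u: "\<And>x t. x > 0 \<Longrightarrow> t > 0 \<Longrightarrow>
      u x t = prefactor t x * bessel_transform \<psi> a b d 0 (c t) (\<beta> t) x"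
  shows "solves_pde \<sigma> \<mu> \<nu> f u"
proof -
  define J where "J n t x = bessel_transform \<psi> a b d n (c t) (\<beta> t) x" for n t x
  \<comment> \<open>The logarithmic x-derivative of the prefactor, with \<open>l'\<close> as its own
    x-derivative; F' = f/x produces the last term.\<close>
  define l where "l t x = m / x - c t - f x / (2 * \<sigma> * x)" for t x
  define l' where "l' x = - (m / x\<^sup>2) - (f' x * x - f x) / (2 * \<sigma> * x\<^sup>2)" for x
  define u\<^sub>x where "u\<^sub>x x t = prefactor t x * (l t x * J 0 t x + J 1 t x)" for x t
  define u\<^sub>x\<^sub>x where "u\<^sub>x\<^sub>x x t = prefactor t x *
    (((l t x)\<^sup>2 + l' x) * J 0 t x + 2 * l t x * J 1 t x + J 2 t x)" for x t
  define u\<^sub>t where "u\<^sub>t x t = prefactor t x *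
    ((- B / (2 * \<sigma>) - 2 * \<sigma> * c t * m + \<sigma> * \<beta> t * x) * J 0 t x +
     (\<sigma> * (x * J 2 t x + (d + 1) * J 1 t x) - 2 * \<sigma> * c t * x * J 1 t x))" for x t
  have J_x: "((\<lambda>x. J n t x) has_real_derivative J (Suc n) t x) (at x)" for n t x
    unfolding J_def using has_real_derivative_bessel_transform[OF \<psi>] d_pos by simp
  have J_t: "((\<lambda>t. J 0 t x) has_real_derivative
      \<sigma> * (x * J 2 t x + (d + 1) * J 1 t x) - 2 * \<sigma> * c t * x * J 1 t x) (at t)" if "t > 0" for t x
    unfolding J_def using d_pos
    by (intro has_real_derivative_bessel_transform_time[OF \<psi> _ that has_derivative_c has_derivative_\<beta>]) auto
  have P_x: "((\<lambda>x. prefactor t x) has_real_derivative prefactor t x * l t x) (at x)"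
    if "x > 0" "t > 0" for x t
  proof -
    have "x * \<beta> t > 0" using \<beta>_pos that by simp
    then have D: "((\<lambda>x. prefactor t x) has_real_derivative
        exp (- (B * t) / (2 * \<sigma>)) * (- (f x / x) / (2 * \<sigma>) * exp (- F x / (2 * \<sigma>))) *
          (x * \<beta> t) powr m * exp (- (c t * x)) +
        exp (- (B * t) / (2 * \<sigma>)) * exp (- F x / (2 * \<sigma>)) *
          (m * (x * \<beta> t) powr (m - 1) * \<beta> t) * exp (- (c t * x)) +
        exp (- (B * t) / (2 * \<sigma>)) * exp (- F x / (2 * \<sigma>)) *
          (x * \<beta> t) powr m * (- c t * exp (- (c t * x)))) (at x)"
      unfolding prefactor_def using pos
      by (auto intro!: derivative_eq_intros F that simp: algebra_simps)
    \<comment> \<open>Expressing the differentiated power through the original one lets the whole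
      prefactor be factored out.\<close>
    have pw: "m * (x * \<beta> t) powr (m - 1) * \<beta> t = (x * \<beta> t) powr m * (m / x)"
      using \<open>x * \<beta> t > 0\<close> that by (simp add: powr_diff)
    show ?thesis
      by (rule DERIV_cong[OF D[unfolded pw]]) (simp add: l_def prefactor_def algebra_simps)
  qed
  have P_t: "((\<lambda>t. prefactor t x) has_real_derivative prefactor t x *
      (- B / (2 * \<sigma>) - 2 * \<sigma> * c t * m + \<sigma> * \<beta> t * x)) (at t)"
    if "x > 0" "t > 0" for x t
  proof -
    have "x * \<beta> t > 0" using \<beta>_pos that by simp
    then have D: "((\<lambda>t. prefactor t x) has_real_derivative
        (- B / (2 * \<sigma>) * exp (- (B * t) / (2 * \<sigma>))) * exp (- F x / (2 * \<sigma>)) *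
          (x * \<beta> t) powr m * exp (- (c t * x)) +
        exp (- (B * t) / (2 * \<sigma>)) * exp (- F x / (2 * \<sigma>)) *
          (m * (x * \<beta> t) powr (m - 1) * (x * - (2 * \<sigma> * c t * \<beta> t))) * exp (- (c t * x)) +
        exp (- (B * t) / (2 * \<sigma>)) * exp (- F x / (2 * \<sigma>)) *
          (x * \<beta> t) powr m * (\<sigma> * \<beta> t * x * exp (- (c t * x)))) (at t)"
      unfolding prefactor_def using pos
      by (auto intro!: derivative_eq_intros has_derivative_c has_derivative_\<beta> that simp: algebra_simps)
    have pw: "m * (x * \<beta> t) powr (m - 1) * (x * - (2 * \<sigma> * c t * \<beta> t)) =
        (x * \<beta> t) powr m * (- (2 * \<sigma> * c t * m))"
      using \<open>x * \<beta> t > 0\<close> that by (simp add: powr_diff)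
    show ?thesis
      by (rule DERIV_cong[OF D[unfolded pw]]) (simp add: prefactor_def algebra_simps)
  qed
  have l_x: "((\<lambda>x. l t x) has_real_derivative l' x) (at x)" if "x > 0" for x t
    unfolding l_def using that pos
    by (auto intro!: derivative_eq_intros f simp: l'_def field_simps power2_eq_square)
  show ?thesis
    unfolding solves_pde_def
  proof (rule exI[of _ u\<^sub>t], rule exI[of _ u\<^sub>x], rule exI[of _ u\<^sub>x\<^sub>x], intro allI impI conjI)
    fix x t :: real assume x: "x > 0" and t: "t > 0"
    have "((\<lambda>t. prefactor t x * J 0 t x) has_real_derivative u\<^sub>t x t) (at t)"
      using DERIV_mult[OF P_t[OF x t] J_t[OF t, of x]] by (simp add: u\<^sub>t_def algebra_simps)
    then show "((\<lambda>s. u x s) has_real_derivative u\<^sub>t x t) (at t)"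
      by (rule has_field_derivative_transform_within_open[where S = "{0<..}"])
         (use x t u in \<open>auto simp: J_def\<close>)
    have "((\<lambda>x. prefactor t x * J 0 t x) has_real_derivative u\<^sub>x x t) (at x)"
      using DERIV_mult[OF P_x[OF x t] J_x[of 0 t x]] by (simp add: u\<^sub>x_def algebra_simps)
    then show "((\<lambda>z. u z t) has_real_derivative u\<^sub>x x t) (at x)"
      by (rule has_field_derivative_transform_within_open[where S = "{0<..}"])
         (use x t u in \<open>auto simp: J_def\<close>)
    show "((\<lambda>z. u\<^sub>x z t) has_real_derivative u\<^sub>x\<^sub>x x t) (at x)"
      unfolding u\<^sub>x_def
      by (rule DERIV_cong[OF DERIV_mult[OF P_x[OF x t]
            DERIV_add[OF DERIV_mult[OF l_x[OF x] J_x] J_x]]])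
         (simp add: u\<^sub>x\<^sub>x_def algebra_simps power2_eq_square flip: numeral_2_eq_2)
    have eq: "- B / (2 * \<sigma>) - 2 * \<sigma> * c t * m + \<sigma> * \<beta> t * x =
        \<sigma> * x * ((l t x)\<^sup>2 + l' x) + f x * l t x - (\<nu> / x + \<mu> * x)" (is "?L = ?R")
    proof -
      \<comment> \<open>Scaling by \<sigma>x removes the denominators; the identity is then proved
        after multiplication by 2\<sigma>x.\<close>
      define L where "L = \<sigma> * x * l t x"
      have L: "L = \<sigma> * m - \<sigma> * c t * x - f x / 2"
        using x pos by (simp add: L_def l_def right_diff_distrib)
      have L': "2 * \<sigma>\<^sup>2 * x\<^sup>2 * l' x = - 2 * \<sigma>\<^sup>2 * m - \<sigma> * x * f' x + \<sigma> * f x"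
      proof -
        have "2 * \<sigma>\<^sup>2 * x\<^sup>2 * (m / x\<^sup>2) = 2 * \<sigma>\<^sup>2 * m"
          using x by simp
        moreover have "2 * \<sigma>\<^sup>2 * x\<^sup>2 * ((f' x * x - f x) / (2 * \<sigma> * x\<^sup>2)) = \<sigma> * (f' x * x - f x)"
          using x pos by (simp add: power2_eq_square)
        ultimately show ?thesis
          unfolding l'_def by (simp only: right_diff_distrib mult_minus_right) simp
      qed
      have \<beta>: "2 * \<sigma>\<^sup>2 * \<beta> t = 2 * \<sigma>\<^sup>2 * (c t)\<^sup>2 - A / 2"
        using pos by (simp add: c_square[OF t] distrib_left)
      have C: "C = 2 * \<sigma>\<^sup>2 * m\<^sup>2 - 2 * \<sigma>\<^sup>2 * m"
        by (simp add: C_eq m_def power2_eq_square field_simps)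
      have "2 * \<sigma> * x * ?L = - B * x - 4 * \<sigma>\<^sup>2 * c t * m * x + (2 * \<sigma>\<^sup>2 * \<beta> t) * x\<^sup>2"
        using pos by (simp add: power2_eq_square field_simps)
      also have "\<dots> = 2 * (\<sigma> * m - \<sigma> * c t * x)\<^sup>2 - 2 * \<sigma>\<^sup>2 * m\<^sup>2 - B * x - 1/2 * A * x\<^sup>2"
        unfolding \<beta> by (simp add: power2_eq_square algebra_simps)
      \<comment> \<open>Here the Riccati equation enters: it trades the terms in A and B for those
        in f, \<nu> and \<mu>, and its constant C is absorbed through C = 2\<sigma>^2 m^2 -
        2\<sigma>^2 m.\<close>
      also have "\<dots> = 2 * (\<sigma> * m - \<sigma> * c t * x)\<^sup>2 - 1/2 * (f x)\<^sup>2 +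
          (- 2 * \<sigma>\<^sup>2 * m - \<sigma> * x * f' x + \<sigma> * f x) - 2 * \<sigma> * \<nu> - 2 * \<sigma> * \<mu> * x\<^sup>2"
        using riccati[OF x] C by linarith
      \<comment> \<open>Because \<sigma>m - \<sigma>cx = L + f/2, the square of f cancels.\<close>
      also have "2 * (\<sigma> * m - \<sigma> * c t * x)\<^sup>2 - 1/2 * (f x)\<^sup>2 = 2 * L\<^sup>2 + 2 * f x * L"
        unfolding L by (simp add: power2_eq_square algebra_simps)
      also have "2 * L\<^sup>2 + 2 * f x * L + (- 2 * \<sigma>\<^sup>2 * m - \<sigma> * x * f' x + \<sigma> * f x) - 2 * \<sigma> * \<nu> - 2 * \<sigma> * \<mu> * x\<^sup>2
          = 2 * \<sigma> * x * ?R"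
        unfolding L'[symmetric] L_def using x by (simp add: power2_eq_square algebra_simps)
      finally show ?thesis using x pos by simp
    qed
    \<comment> \<open>The drift f cancels against the contribution of \<open>F\<close> to
      \<open>l\<close>, and 2m = d + 1.\<close>
    have eq1: "2 * \<sigma> * x * l t x + f x = \<sigma> * (d + 1) - 2 * \<sigma> * c t * x"
      using x pos by (simp add: l_def m_def right_diff_distrib)
    have eq2: "\<sigma> * x * (P * (L2 * J0 + 2 * L * J1 + J2)) + f x * (P * (L * J0 + J1)) - N * (P * J0) =
        P * ((\<sigma> * x * L2 + f x * L - N) * J0 + (2 * \<sigma> * x * L + f x) * J1 + \<sigma> * x * J2)"
      for P L2 L J0 J1 J2 N
      by (simp add: algebra_simps)
    have eq3: "E * J0 + (\<sigma> * (x * J2 + (d + 1) * J1) - 2 * \<sigma> * c t * x * J1) =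
        E * J0 + (\<sigma> * (d + 1) - 2 * \<sigma> * c t * x) * J1 + \<sigma> * x * J2" for E J0 J1 J2
      by (simp add: algebra_simps)
    show "u\<^sub>t x t = \<sigma> * x * u\<^sub>x\<^sub>x x t + f x * u\<^sub>x x t - (\<nu> / x + \<mu> * x) * u x t"
      unfolding u\<^sub>t_def u\<^sub>x\<^sub>x_def u\<^sub>x_def u[OF x t] J_def[symmetric] eq2 eq3
      unfolding eq eq1 ..
  qed
qed

section \<open>The initial condition\<close>

text \<open>Written in 1/c and \<beta>/c^2, because these tend to 0 and 1 as t decreases to
  0.\<close>

definition normalizer where
  "normalizer t x = exp (- (B * t) / (2 * \<sigma>)) * exp (- F x / (2 * \<sigma>)) *
     (x * (\<beta> t / (c t)\<^sup>2)) powr m * exp (- (A / (4 * \<sigma>\<^sup>2) * x * (1 / c t)))"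

text \<open>By \<open>c_square\<close>, exp(-cx) contains the Poisson normalization
  exp(-x\<beta>/c), and 2m = d + 1 extracts the power c^(d+1) from (x\<beta>)^m. What is left over
  forms the normalizer.\<close>

lemma kernel_eq_density:
  assumes "t > 0" "x > 0" "y > 0"
  shows "kernel t x y = normalizer t x *
    (exp (F y / (2 * \<sigma>)) * y powr (- m) * bessel_density d (x * \<beta> t) (c t) y)"
proof -
  have c: "c t > 0" and \<beta>: "\<beta> t > 0" using c_pos \<beta>_pos assms(1) by auto
  have "exp (- (A / (4 * \<sigma>\<^sup>2) * x * (1 / c t))) * exp (- (x * \<beta> t / c t)) =
      exp (- (x * (\<beta> t + A / (4 * \<sigma>\<^sup>2)) / c t))"
    by (simp add: algebra_simps add_divide_distrib flip: exp_add)
  also have "x * (\<beta> t + A / (4 * \<sigma>\<^sup>2)) / c t = c t * x"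
    unfolding c_square[OF assms(1), symmetric] using c by (simp add: power2_eq_square)
  finally have 1: "exp (- (c t * x)) = exp (- (A / (4 * \<sigma>\<^sup>2) * x * (1 / c t))) * exp (- (x * \<beta> t / c t))"
    by simp
  have "(c t)\<^sup>2 powr m = c t powr (d + 1)"
  proof -
    have "(c t)\<^sup>2 powr m = c t powr (2 * m)"
      using c by (simp add: powr_powr flip: powr_numeral)
    also have "2 * m = d + 1" by (simp add: m_def)
    finally show ?thesis .
  qed
  then have 2: "(x * \<beta> t) powr m = (x * (\<beta> t / (c t)\<^sup>2)) powr m * c t powr (d + 1)"
    using c \<beta> assms by (simp add: powr_divide)
  have 3: "y powr ((d - 1) / 2) = y powr (- m) * y powr d"
    using assms by (simp add: m_def field_simps flip: powr_add)
  show ?thesis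
    unfolding kernel_eq[OF assms] prefactor_def weight_def normalizer_def bessel_density_def 1 2 3
    using assms by (simp add: mult_ac)
qed

lemma tendsto_inverse_c: "((\<lambda>t. 1 / c t) \<longlongrightarrow> 0) (at_right 0)"
proof -
  have "((\<lambda>t. 2 * \<sigma> * sinh (sqrt A * t / 2) / (sqrt A * cosh (sqrt A * t / 2))) \<longlongrightarrow>
      2 * \<sigma> * sinh (sqrt A * 0 / 2) / (sqrt A * cosh (sqrt A * 0 / 2))) (at_right 0)"
    using pos by (intro tendsto_intros) auto
  then show ?thesis by (simp add: c_def)
qed

lemma tendsto_\<beta>_over_c: "((\<lambda>t. \<beta> t / (c t)\<^sup>2) \<longlongrightarrow> 1) (at_right 0)"
proof -
  have lim: "((\<lambda>t. 1 - A / (4 * \<sigma>\<^sup>2) * (1 / c t)\<^sup>2) \<longlongrightarrow> 1 - A / (4 * \<sigma>\<^sup>2) * 0\<^sup>2) (at_right 0)"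
    by (intro tendsto_intros tendsto_inverse_c)
  have "\<forall>\<^sub>F t in at_right 0. 1 - A / (4 * \<sigma>\<^sup>2) * (1 / c t)\<^sup>2 = \<beta> t / (c t)\<^sup>2"
    using eventually_at_right_less[of 0]
  proof eventually_elim
    case (elim t)
    have "\<beta> t = (c t)\<^sup>2 - A / (4 * \<sigma>\<^sup>2)" using c_square[OF elim] by simp
    then show ?case
      using c_pos[OF elim] by (simp add: diff_divide_distrib power_divide)
  qed
  from Lim_transform_eventually[OF lim this] show ?thesis by simp
qed

lemma tendsto_normalizer:
  assumes "x > 0"
  shows "((\<lambda>t. normalizer t x) \<longlongrightarrow> exp (- F x / (2 * \<sigma>)) * x powr m) (at_right 0)"
proof -
  have "((\<lambda>t. normalizer t x) \<longlongrightarrow> exp (- (B * 0) / (2 * \<sigma>)) * exp (- F x / (2 * \<sigma>)) *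
      (x * 1) powr m * exp (- (A / (4 * \<sigma>\<^sup>2) * x * 0))) (at_right 0)"
    unfolding normalizer_def using pos assms
    by (intro tendsto_intros tendsto_inverse_c tendsto_\<beta>_over_c) auto
  then show ?thesis by simp
qed

lemma tendsto_integral_bessel_density:
  fixes h :: "real \<Rightarrow> real"
  assumes x: "x > 0" and h: "h \<in> borel_measurable lborel" "\<And>y. \<bar>h y\<bar> \<le> M" "isCont h x"
  shows "((\<lambda>t. \<integral>y. h y * bessel_density d (x * \<beta> t) (c t) y \<partial>lborel) \<longlongrightarrow> h x) (at_right 0)"
proof -
  let ?r = "\<lambda>t. x * \<beta> t / c t"
  let ?V = "\<lambda>t. ((d + 1) * (d + 2) + 2 * (d + 2) * ?r t + (?r t)\<^sup>2) / (c t)\<^sup>2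
    - 2 * x * ((d + 1 + ?r t) / c t) + x\<^sup>2"
  have dens: "\<forall>\<^sub>F t in at_right 0. (\<forall>y. 0 \<le> bessel_density d (x * \<beta> t) (c t) y) \<and>
      has_bochner_integral lborel (bessel_density d (x * \<beta> t) (c t)) 1 \<and>
      has_bochner_integral lborel (\<lambda>y. (y - x)\<^sup>2 * bessel_density d (x * \<beta> t) (c t) y) (?V t)"
    using eventually_at_right_less[of 0]
  proof eventually_elim
    case (elim t)
    have b: "x * \<beta> t \<ge> 0" and c: "c t > 0" and d: "d \<ge> 0"
      using x c_pos[OF elim] \<beta>_pos[OF elim] d_pos by simp_all
    show ?case
      using has_bochner_integral_bessel_density[OF b c d] bessel_density_nonneg[OF d b] by simp
  qed
  \<comment> \<open>The second moment about x is a polynomial in 1/c and \<beta>/c^2; in the limit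
    only x^2 - 2x^2 + x^2 = 0 survives.\<close>
  let ?i = "\<lambda>t. 1 / c t" and ?\<rho> = "\<lambda>t. \<beta> t / (c t)\<^sup>2"
  have "((\<lambda>t. (d + 1) * (d + 2) * (?i t)\<^sup>2 + 2 * (d + 2) * (x * ?\<rho> t) * ?i t + (x * ?\<rho> t)\<^sup>2
      - 2 * x * ((d + 1) * ?i t + x * ?\<rho> t) + x\<^sup>2) \<longlongrightarrow>
      (d + 1) * (d + 2) * 0\<^sup>2 + 2 * (d + 2) * (x * 1) * 0 + (x * 1)\<^sup>2
      - 2 * x * ((d + 1) * 0 + x * 1) + x\<^sup>2) (at_right 0)"
    by (intro tendsto_intros tendsto_inverse_c tendsto_\<beta>_over_c)
  moreover have "(d + 1) * (d + 2) * (?i t)\<^sup>2 + 2 * (d + 2) * (x * ?\<rho> t) * ?i t + (x * ?\<rho> t)\<^sup>2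
      - 2 * x * ((d + 1) * ?i t + x * ?\<rho> t) + x\<^sup>2 = ?V t" for t
    by (simp add: add_divide_distrib power_divide power2_eq_square)
  moreover have "(x * 1)\<^sup>2 - 2 * x * (x * 1) + x\<^sup>2 = 0" by (simp add: power2_eq_square)
  ultimately have "(?V \<longlongrightarrow> 0) (at_right 0)" by simp
  from tendsto_integral_concentrating[OF dens this h] show ?thesis .
qed

lemma continuous_on_F: "continuous_on {0<..} F"
  using F by (auto intro!: continuous_at_imp_continuous_on DERIV_isCont)

text \<open>The factor sqrt(Axy) vanishes. Hence u(0,t) = 0, in accordance with \<phi>(0) =
  0.\<close>

lemma kernel_0: "kernel t 0 y = 0"
  by (simp add: kernel_def)

text \<open>\<open>kernel_eq\<close> reduces u to an integral over a compact interval and so gives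
  the PDE; \<open>kernel_eq_density\<close> gives the limit as t decreases to 0.\<close>

lemma fundamental_solution_kernel: "fundamental_solution \<sigma> \<mu> \<nu> f kernel"
  unfolding fundamental_solution_def Let_def
proof (intro allI impI, elim conjE)
  fix \<phi> :: "real \<Rightarrow> real"
  assume \<phi>: "continuous_on UNIV \<phi>" and supp: "compact (closure {y. \<phi> y \<noteq> 0})"
    "closure {y. \<phi> y \<noteq> 0} \<subseteq> {0<..}"
  obtain a b where ab: "0 < a" "a \<le> b" "closure {y. \<phi> y \<noteq> 0} \<subseteq> {a..b}"
    using compact_subset_pos_interval[OF supp] .
  have \<phi>_0: "\<phi> y = 0" if "y \<notin> {a..b}" for y
    using that ab(3) closure_subset[of "{y. \<phi> y \<noteq> 0}"] by auto
  have cont: "continuous_on {a..b} \<phi>" "continuous_on {a..b} F"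
    using ab(1) by (auto intro: continuous_on_subset[OF \<phi>] continuous_on_subset[OF continuous_on_F])
  define \<psi> where "\<psi> y = \<phi> y * weight y" for y
  have \<psi>: "continuous_on {a..b} \<psi>"
    unfolding \<psi>_def weight_def using ab(1) pos by (intro continuous_intros cont) auto
  \<comment> \<open>The trivial power and the summand \<open>real 0\<close> match the case n = 0 of
    \<open>bessel_transform\<close>.\<close>
  define k where "k t x y = prefactor t x * (\<psi> y * ((\<beta> t * y) ^ 0 * exp (- (c t * y)) *
    bessel_clifford (d + real 0) (\<beta> t * x * y)))" for t x y
  have k_eq: "indicator {0<..} y *\<^sub>R (\<phi> y * kernel t x y) = indicator {a..b} y *\<^sub>R k t x y"
    if "t > 0" "x > 0" for t x y
  proof (cases "y \<in> {a..b}")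
    case True
    then show ?thesis using ab(1) that by (simp add: kernel_eq k_def \<psi>_def mult_ac)
  qed (simp add: \<phi>_0)
  have k_int: "set_integrable lborel {a..b} (k t x)" for t x
    unfolding k_def using d_pos
    by (intro borel_integrable_atLeastAtMost' continuous_intros \<psi>) auto
  define u where "u x t = (LINT y:{0<..}|lborel. \<phi> y * kernel t x y)" for x t
  have u_eq: "u x t = prefactor t x * bessel_transform \<psi> a b d 0 (c t) (\<beta> t) x"
    if "x > 0" "t > 0" for x t
  proof -
    have "u x t = (LINT y:{a..b}|lborel. k t x y)"
      using that by (simp only: u_def set_lebesgue_integral_def k_eq)
    also have "\<dots> = integral {a..b} (k t x)"
      by (rule set_borel_integral_eq_integral[OF k_int])
    finally show ?thesis by (simp add: k_def[abs_def] bessel_transform_def)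
  qed
  \<comment> \<open>The y-dependent factor beside the density. At y = x it is cancelled by the limit
    of the normalizer, which leaves \<phi>(x).\<close>
  define h where "h y = \<phi> y * (exp (F y / (2 * \<sigma>)) * y powr (- m))" for y
  have h_cont: "continuous_on {a..b} h"
    unfolding h_def using ab(1) pos by (intro continuous_intros cont) auto
  \<comment> \<open>Continuity of \<open>h\<close> is available on [a,b]; as \<open>h\<close>
    vanishes outside, multiplying by the indicator changes nothing and yields measurability on the
    whole line.\<close>
  have "(\<lambda>y. indicator {a..b} y *\<^sub>R h y) \<in> borel_measurable borel"
    by (intro borel_measurable_continuous_on_indicator h_cont) auto
  moreover have "(\<lambda>y. indicator {a..b} y *\<^sub>R h y) = h"
    using \<phi>_0 by (intro ext) (auto simp: indicator_def h_def)
  ultimately have h_meas: "h \<in> borel_measurable lborel" by simp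
  have "bounded (h ` {a..b})"
    by (intro compact_imp_bounded compact_continuous_image h_cont compact_Icc)
  then obtain M where M: "\<And>y. y \<in> {a..b} \<Longrightarrow> \<bar>h y\<bar> \<le> M"
    unfolding bounded_real by blast
  have h_bound: "\<bar>h y\<bar> \<le> \<bar>M\<bar>" for y
    using M[of y] \<phi>_0[of y] by (cases "y \<in> {a..b}") (auto simp: h_def)
  have limit: "((\<lambda>t. u x t) \<longlongrightarrow> \<phi> x) (at_right 0)" if "x \<ge> 0" for x
  proof (cases "x = 0")
    case True
    then show ?thesis using ab(1) \<phi>_0 by (simp add: u_def kernel_0)
  next
    case False
    with that have x: "x > 0" by simp
    have "isCont \<phi> x" using \<phi> by (simp add: continuous_on_eq_continuous_at)
    then have "isCont h x"
      unfolding h_def using x pos DERIV_isCont[OF F[OF x]] by (intro continuous_intros) auto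
    then have lim: "((\<lambda>t. normalizer t x * (\<integral>y. h y * bessel_density d (x * \<beta> t) (c t) y \<partial>lborel)) \<longlongrightarrow>
        (exp (- F x / (2 * \<sigma>)) * x powr m) * h x) (at_right 0)"
      by (intro tendsto_mult tendsto_normalizer tendsto_integral_bessel_density[OF x h_meas h_bound] x)
    have h_x: "(exp (- F x / (2 * \<sigma>)) * x powr m) * h x = \<phi> x"
      using x by (simp add: h_def powr_minus exp_minus field_simps)
    have "\<forall>\<^sub>F t in at_right 0.
        normalizer t x * (\<integral>y. h y * bessel_density d (x * \<beta> t) (c t) y \<partial>lborel) = u x t"
      using eventually_at_right_less[of 0]
    proof eventually_elim
      case (elim t)
      have "indicator {0<..} y *\<^sub>R (\<phi> y * kernel t x y) =
          normalizer t x * (h y * bessel_density d (x * \<beta> t) (c t) y)" for y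
      proof (cases "y > 0")
        case True
        then show ?thesis using kernel_eq_density[OF elim x True] by (simp add: h_def)
      qed (simp add: bessel_density_def)
      then show ?case by (simp add: u_def set_lebesgue_integral_def)
    qed
    from Lim_transform_eventually[OF lim this] show ?thesis by (simp only: h_x)
  qed
  have integrable: "set_integrable lborel {0<..} (\<lambda>y. \<phi> y * kernel t x y)" if "x \<ge> 0" "t > 0" for x t
  proof (cases "x = 0")
    case True
    then show ?thesis by (simp add: kernel_0 set_integrable_def)
  next
    case False
    then show ?thesis using that k_int[of t x] by (simp add: set_integrable_def k_eq[simplified])
  qed
  show "(\<forall>x\<ge>0. \<forall>t>0. set_integrable lborel {0<..} (\<lambda>y. \<phi> y * kernel t x y)) \<and>
      solves_pde \<sigma> \<mu> \<nu> f (\<lambda>x t. LINT y:{0<..}|lborel. \<phi> y * kernel t x y) \<and>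
      (\<forall>x\<ge>0. ((\<lambda>t. LINT y:{0<..}|lborel. \<phi> y * kernel t x y) \<longlongrightarrow> \<phi> x) (at_right 0))"
    using integrable limit integral_representation_solves[OF \<psi> u_eq]
    by (simp add: u_def[abs_def])
qed

end

theorem theorem5p10:
  fixes \<sigma> \<mu> \<nu> A B C d :: real and f f' F :: "real \<Rightarrow> real"
  assumes "\<sigma> > 0" and "\<mu> > 0" and "\<nu> > 0" and "A > 0"
    and "\<And>x. x > 0 \<Longrightarrow> (f has_real_derivative f' x) (at x)"
    and "\<And>x. x > 0 \<Longrightarrow>
      \<sigma> * x * f' x - \<sigma> * f x + 1/2 * (f x)\<^sup>2 + 2 * \<sigma> * \<nu> + 2 * \<sigma> * \<mu> * x\<^sup>2
        = 1/2 * A * x\<^sup>2 + B * x + C"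
    and "\<And>x. x > 0 \<Longrightarrow> (F has_real_derivative f x / x) (at x)"
    and "d = sqrt (\<sigma>\<^sup>2 + 2 * C) / \<sigma>"
  shows "\<exists>C\<^sub>1 C\<^sub>2 :: real \<Rightarrow> real. fundamental_solution \<sigma> \<mu> \<nu> f
    (\<lambda>t x y.
      sqrt (A * x * y) / (2 * \<sigma> * sinh (sqrt A * t / 2))
      * exp (- (B * t + sqrt A * (x + y) * (cosh (sqrt A * t / 2) / sinh (sqrt A * t / 2))
                + F x - F y) / (2 * \<sigma>))
      * (C\<^sub>1 y * bessel_I d (sqrt (A * x * y) / (\<sigma> * sinh (sqrt A * t / 2)))
         + C\<^sub>2 y * bessel_I_neg d (sqrt (A * x * y) / (\<sigma> * sinh (sqrt A * t / 2)))))"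
proof -
  interpret riccati_diffusion \<sigma> \<mu> \<nu> A B C d f f' F
    by unfold_locales (use assms in auto)
  show ?thesis
    by (rule exI[of _ "\<lambda>y. 1 / y"], rule exI[of _ "\<lambda>y. 0"])
       (rule fundamental_solution_kernel[unfolded kernel_def[abs_def]])
qed

end
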